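(* Let $\gamma$ be a gauge on $\mathbb{R}^d$ with skewness $\sigma$ and let $v\in\mathrm{SD}_\gamma$. Let $C\subset\mathbb{R}^d$ be a finite set with positive weights $w_c$, $w_C=\sum_{c\in C}w_c$, and for $M>0$ define $h_M(x)=\sum_{c\in C}w_c\,\gamma(x-c+Mv)$. Let $U\subset\mathbb{R}^d$ be bounded and $\tau>0$. Then there exists $M_{U,\tau}>0$ such that for every $M>M_{U,\tau}$, every $u\in U$ and every $q\in\partial h_M(u)$ we have $\gamma^\circ(-q)>\sigma w_C-\tau$.
   Context: A gauge $\gamma$ on $\mathbb{R}^d$ is the Minkowski functional of a convex compact set $B_\gamma$ with the origin in its interior (not necessarily symmetric). The dual gauge is $\gamma^\circ(p)=\max\{\langle p,x\rangle:\gamma(x)=1\}$. $\partial$ denotes the convex subdifferential. The skewness is $\sigma=\sup_{x\neq0}\gamma(x)/\gamma(-x)$ and $\mathrm{SD}_\gamma=\{v:\gamma(v)=\sigma\gamma(-v)=1\}$. *)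

theory Defs
  imports "HOL-Analysis.Analysis"
begin

text \<open>Minkowski functional (gauge) of a set B: inf of t > 0 with x in t B.\<close>
definition minkowski_gauge :: "'a::euclidean_space set \<Rightarrow> 'a \<Rightarrow> real" where
  "minkowski_gauge B x = Inf {t. t > 0 \<and> x \<in> (\<lambda>y. t *\<^sub>R y) ` B}"

text \<open>Dual gauge: max of the pairing over the unit sphere of the gauge.\<close>
definition dual_gauge :: "('a::euclidean_space \<Rightarrow> real) \<Rightarrow> 'a \<Rightarrow> real" where
  "dual_gauge g p = Sup ((\<lambda>x. p \<bullet> x) ` {x. g x = 1})"

text \<open>Skewness of a gauge.\<close>
definition skewness :: "('a::euclidean_space \<Rightarrow> real) \<Rightarrow> real" where
  "skewness g = Sup ((\<lambda>x. g x / g (- x)) ` {x. x \<noteq> 0})"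

text \<open>Directions of maximal skewness.\<close>
definition SD :: "('a::euclidean_space \<Rightarrow> real) \<Rightarrow> 'a set" where
  "SD g = {v. g v = 1 \<and> skewness g * g (- v) = 1}"

text \<open>Convex subdifferential.\<close>
definition subdiff :: "('a::euclidean_space \<Rightarrow> real) \<Rightarrow> 'a \<Rightarrow> 'a set" where
  "subdiff f x = {q. \<forall>y. f y \<ge> f x + q \<bullet> (y - x)}"

end

theory Submission
  imports Defs
begin

text \<open>
  Testing the subgradient inequality of \<open>h\<^sub>M\<close> at \<open>u - M v\<close> gives
  \<open>h\<^sub>M u - h\<^sub>M (u - M v) \<le> M \<langle>q, v\<rangle>\<close>, and \<open>h\<^sub>M (u - M v) = \<Sum> w\<^sub>c \<gamma>(u - c)\<close> no longer
  depends on \<open>M\<close>. Since \<open>\<gamma>(M v) = M\<close> and \<open>\<gamma>\<close> is subadditive,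
  \<open>\<gamma>(u - c + M v) \<ge> M - \<gamma>(c - u)\<close>, so \<open>M \<langle>q, v\<rangle> \<ge> M w\<^sub>C - K\<close> with \<open>K\<close> bounding
  \<open>\<Sum> w\<^sub>c (\<gamma>(c - u) + \<gamma>(u - c))\<close> uniformly on the bounded set \<open>U\<close>.
  Because \<open>v \<in> SD\<^sub>\<gamma>\<close>, the point \<open>-\<sigma> v\<close> lies on the unit sphere of \<open>\<gamma>\<close>, whence
  \<open>\<gamma>\<degree>(-q) \<ge> \<sigma> \<langle>q, v\<rangle> \<ge> \<sigma> w\<^sub>C - \<sigma> K / M\<close>, which exceeds \<open>\<sigma> w\<^sub>C - \<tau>\<close> once \<open>M > \<sigma> K / \<tau>\<close>.
\<close>

lemma minkowski_gauge_le:
  fixes B :: "'a::euclidean_space set"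
  assumes "t > 0" "x \<in> (*\<^sub>R) t ` B"
  shows "minkowski_gauge B x \<le> t"
  unfolding minkowski_gauge_def
  by (rule cInf_lower) (use assms in \<open>auto intro: bdd_belowI[of _ 0]\<close>)

lemma scaleR_image_cball_mem:
  fixes B :: "'a::euclidean_space set"
  assumes "cball 0 r \<subseteq> B" "t > 0" "norm x \<le> t * r"
  shows "x \<in> (*\<^sub>R) t ` B"
proof
  show "(1 / t) *\<^sub>R x \<in> B"
    using assms by (auto simp: field_simps intro!: subsetD[OF assms(1)])
qed (use assms in simp)

lemma minkowski_gauge_le_mult_norm:
  fixes B :: "'a::euclidean_space set"
  assumes "0 \<in> interior B"
  obtains L where "L \<ge> 0" "\<And>x. minkowski_gauge B x \<le> L * norm x"
proof -
  obtain r where "r > 0" "cball 0 r \<subseteq> B"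
    using assms mem_interior_cball by blast
  have "minkowski_gauge B x \<le> norm x / r" for x
  proof (rule field_le_epsilon)
    fix e :: real
    assume "e > 0"
    with \<open>r > 0\<close> \<open>cball 0 r \<subseteq> B\<close> have "x \<in> (*\<^sub>R) (norm x / r + e) ` B"
      by (intro scaleR_image_cball_mem) (auto simp: field_simps add_nonneg_pos add_pos_nonneg)
    with \<open>e > 0\<close> \<open>r > 0\<close> show "minkowski_gauge B x \<le> norm x / r + e"
      by (intro minkowski_gauge_le) (auto simp: add_nonneg_pos)
  qed
  with \<open>r > 0\<close> show ?thesis
    by (intro that[of "1 / r"]) auto
qed

text \<open>Absorbency of \<open>B\<close> keeps the gauge away from the unspecified value \<open>Inf {}\<close>.\<close>

lemma minkowski_gauge_set_nonempty:
  fixes B :: "'a::euclidean_space set"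
  assumes "0 \<in> interior B"
  shows "{t. t > 0 \<and> x \<in> (*\<^sub>R) t ` B} \<noteq> {}"
proof -
  obtain r where "r > 0" "cball 0 r \<subseteq> B"
    using assms mem_interior_cball by blast
  then have "x \<in> (*\<^sub>R) (norm x / r + 1) ` B"
    by (intro scaleR_image_cball_mem) (auto simp: field_simps add_nonneg_pos add_pos_nonneg)
  moreover have "norm x / r + 1 > 0"
    using \<open>r > 0\<close> by (simp add: add_nonneg_pos)
  ultimately show ?thesis by blast
qed

lemma minkowski_gauge_nonneg:
  fixes B :: "'a::euclidean_space set"
  assumes "0 \<in> interior B"
  shows "0 \<le> minkowski_gauge B x"
  unfolding minkowski_gauge_def
  by (rule cInf_greatest[OF minkowski_gauge_set_nonempty[OF assms]]) auto

lemma minkowski_gauge_lt_imp_mem: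
  fixes B :: "'a::euclidean_space set"
  assumes "convex B" "0 \<in> interior B" "minkowski_gauge B x < t"
  shows "x \<in> (*\<^sub>R) t ` B"
proof -
  obtain s b where "s < t" "s > 0" "b \<in> B" "x = s *\<^sub>R b"
    using cInf_lessD[OF minkowski_gauge_set_nonempty[OF assms(2)]] assms(3)
    unfolding minkowski_gauge_def by blast
  moreover have "0 \<in> B"
    using assms(2) interior_subset by blast
  ultimately have "(s / t) *\<^sub>R b \<in> B"
    using convexD[OF assms(1) \<open>b \<in> B\<close> \<open>0 \<in> B\<close>, of "s / t" "1 - s / t"] by simp
  moreover have "x = t *\<^sub>R ((s / t) *\<^sub>R b)"
    using \<open>s > 0\<close> \<open>s < t\<close> \<open>x = s *\<^sub>R b\<close> by simp
  ultimately show ?thesis by blast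
qed

lemma minkowski_gauge_scaleR:
  fixes B :: "'a::euclidean_space set"
  assumes "0 \<in> interior B" "s > 0"
  shows "minkowski_gauge B (s *\<^sub>R x) = s * minkowski_gauge B x"
proof -
  have "{t. t > 0 \<and> s *\<^sub>R x \<in> (*\<^sub>R) t ` B} = (*) s ` {t. t > 0 \<and> x \<in> (*\<^sub>R) t ` B}"
  proof (intro equalityI subsetI)
    fix t
    assume "t \<in> {t. t > 0 \<and> s *\<^sub>R x \<in> (*\<^sub>R) t ` B}"
    then obtain b where "t > 0" "b \<in> B" "s *\<^sub>R x = t *\<^sub>R b" by auto
    then have "x = (t / s) *\<^sub>R b"
      using \<open>s > 0\<close> by (metis (no_types) eq_vector_fraction_iff less_irrefl)
    then show "t \<in> (*) s ` {t. t > 0 \<and> x \<in> (*\<^sub>R) t ` B}"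
      using \<open>s > 0\<close> \<open>t > 0\<close> \<open>b \<in> B\<close> by (auto intro!: image_eqI[of _ _ "t / s"])
  qed (use \<open>s > 0\<close> in auto)
  moreover have "continuous (at_right a) ((*) s)" for a :: real
    by (intro continuous_intros)
  ultimately show ?thesis
    unfolding minkowski_gauge_def using \<open>s > 0\<close> minkowski_gauge_set_nonempty[OF assms(1)]
    by (subst continuous_at_Inf_mono) (auto simp: mono_def image_image intro: bdd_belowI[of _ 0])
qed

lemma minkowski_gauge_triangle:
  fixes B :: "'a::euclidean_space set"
  assumes "convex B" "0 \<in> interior B"
  shows "minkowski_gauge B (x + y) \<le> minkowski_gauge B x + minkowski_gauge B y"
proof (rule field_le_epsilon)
  fix e :: real
  assume "e > 0"
  define a where "a = minkowski_gauge B x + e / 2"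
  define c where "c = minkowski_gauge B y + e / 2"
  have "a > 0" "c > 0"
    using \<open>e > 0\<close> minkowski_gauge_nonneg[OF assms(2)] unfolding a_def c_def
    by (auto intro: add_nonneg_pos)
  obtain b1 b2 where "b1 \<in> B" "x = a *\<^sub>R b1" "b2 \<in> B" "y = c *\<^sub>R b2"
    using minkowski_gauge_lt_imp_mem[OF assms, of x a] minkowski_gauge_lt_imp_mem[OF assms, of y c]
      \<open>e > 0\<close> unfolding a_def c_def by auto
  have "(a / (a + c)) *\<^sub>R b1 + (c / (a + c)) *\<^sub>R b2 \<in> B"
    using convexD[OF assms(1) \<open>b1 \<in> B\<close> \<open>b2 \<in> B\<close>] \<open>a > 0\<close> \<open>c > 0\<close>
    by (simp add: add_divide_distrib[symmetric])
  moreover have "x + y = (a + c) *\<^sub>R ((a / (a + c)) *\<^sub>R b1 + (c / (a + c)) *\<^sub>R b2)"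
    using \<open>x = a *\<^sub>R b1\<close> \<open>y = c *\<^sub>R b2\<close> \<open>a > 0\<close> \<open>c > 0\<close> by (simp add: scaleR_add_right)
  ultimately have "minkowski_gauge B (x + y) \<le> a + c"
    using \<open>a > 0\<close> \<open>c > 0\<close> by (intro minkowski_gauge_le) auto
  then show "minkowski_gauge B (x + y) \<le> minkowski_gauge B x + minkowski_gauge B y + e"
    unfolding a_def c_def by simp
qed

lemma norm_le_minkowski_gauge:
  fixes B :: "'a::euclidean_space set"
  assumes "0 \<in> interior B" "R > 0" "B \<subseteq> cball 0 R"
  shows "norm x \<le> R * minkowski_gauge B x"
proof -
  have "norm x / R \<le> t" if "t > 0" "x \<in> (*\<^sub>R) t ` B" for t
  proof -
    obtain b where "b \<in> B" "x = t *\<^sub>R b"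
      using \<open>x \<in> (*\<^sub>R) t ` B\<close> by blast
    then have "norm x \<le> t * R"
      using assms(3) \<open>t > 0\<close> by (auto intro: mult_left_mono)
    then show ?thesis
      using \<open>R > 0\<close> by (simp add: field_simps)
  qed
  then have "norm x / R \<le> minkowski_gauge B x"
    unfolding minkowski_gauge_def
    by (intro cInf_greatest[OF minkowski_gauge_set_nonempty[OF assms(1)]]) auto
  then show ?thesis
    using \<open>R > 0\<close> by (simp add: field_simps)
qed

lemma inner_le_dual_gauge:
  assumes "bounded {x. g x = 1}" "g x = 1"
  shows "p \<bullet> x \<le> dual_gauge g p"
proof -
  have "bounded ((\<bullet>) p ` {x. g x = 1})"
    using assms(1) by (intro bounded_linear_image) (auto intro: bounded_linear_inner_right)
  then show ?thesis
    unfolding dual_gauge_def using assms(2) by (intro cSup_upper bounded_imp_bdd_above) auto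
qed

lemma bounded_minkowski_gauge_sphere:
  fixes B :: "'a::euclidean_space set"
  assumes "bounded B" "0 \<in> interior B"
  shows "bounded {x. minkowski_gauge B x = 1}"
proof -
  obtain R where "R > 0" "B \<subseteq> cball 0 R"
    using assms(1) by (metis bounded_pos mem_cball_0 subsetI)
  then show ?thesis
    using norm_le_minkowski_gauge[OF assms(2) \<open>R > 0\<close> \<open>B \<subseteq> cball 0 R\<close>]
    by (intro boundedI[of _ R]) (metis mem_Collect_eq mult.right_neutral)
qed

lemma SD_imp_skewness_pos:
  fixes B :: "'a::euclidean_space set"
  assumes "0 \<in> interior B" "v \<in> SD (minkowski_gauge B)"
  shows "skewness (minkowski_gauge B) > 0"
proof -
  have "skewness (minkowski_gauge B) * minkowski_gauge B (- v) = 1"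
    using assms(2) unfolding SD_def by simp
  then show ?thesis
    using minkowski_gauge_nonneg[OF assms(1), of "- v"]
      mult_nonpos_nonneg[of "skewness (minkowski_gauge B)" "minkowski_gauge B (- v)"]
    by linarith
qed

lemma skewness_inner_le_dual_gauge:
  fixes B :: "'a::euclidean_space set"
  assumes "bounded B" "0 \<in> interior B" "v \<in> SD (minkowski_gauge B)"
  shows "skewness (minkowski_gauge B) * (q \<bullet> v) \<le> dual_gauge (minkowski_gauge B) (- q)"
proof -
  let ?\<sigma> = "skewness (minkowski_gauge B)"
  have "minkowski_gauge B (- (?\<sigma> *\<^sub>R v)) = 1"
    using assms(3) minkowski_gauge_scaleR[OF assms(2) SD_imp_skewness_pos[OF assms(2,3)], of "- v"]
    unfolding SD_def by simp
  then show ?thesis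
    using inner_le_dual_gauge[OF bounded_minkowski_gauge_sphere[OF assms(1,2)], of "- (?\<sigma> *\<^sub>R v)" "- q"]
    by simp
qed

lemma weighted_gauge_sum_bounded:
  fixes g :: "'a::real_normed_vector \<Rightarrow> real"
  assumes "bounded U" "L \<ge> 0" "\<And>x. g x \<le> L * norm x" "\<forall>c\<in>C. w c \<ge> 0"
  obtains K where "\<And>u. u \<in> U \<Longrightarrow> (\<Sum>c\<in>C. w c * (g (c - u) + g (u - c))) \<le> K"
proof -
  obtain R where R: "\<forall>u\<in>U. norm u \<le> R"
    using assms(1) bounded_iff by blast
  have "g (c - u) + g (u - c) \<le> 2 * L * (norm c + R)" if "u \<in> U" for u c
  proof -
    have "g (c - u) + g (u - c) \<le> 2 * L * norm (u - c)"
      using assms(3)[of "c - u"] assms(3)[of "u - c"] by (simp add: norm_minus_commute)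
    also have "\<dots> \<le> 2 * L * (norm c + R)"
      using R \<open>u \<in> U\<close> \<open>L \<ge> 0\<close> norm_triangle_ineq4[of u c]
      by (intro mult_left_mono) auto
    finally show ?thesis .
  qed
  with assms(4) show ?thesis
    by (intro that[of "\<Sum>c\<in>C. w c * (2 * L * (norm c + R))"] sum_mono mult_left_mono) auto
qed

lemma subgradient_inner_lower_bound:
  fixes g :: "'a::euclidean_space \<Rightarrow> real"
  assumes triangle: "\<And>x y. g (x + y) \<le> g x + g y"
    and "g (M *\<^sub>R v) = M" "\<forall>c\<in>C. w c \<ge> 0"
    and "q \<in> subdiff (\<lambda>x. \<Sum>c\<in>C. w c * g (x - c + M *\<^sub>R v)) u"
  shows "M * (\<Sum>c\<in>C. w c) - (\<Sum>c\<in>C. w c * (g (c - u) + g (u - c))) \<le> M * (q \<bullet> v)"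
proof -
  have subgradient: "(\<Sum>c\<in>C. w c * g (u - c + M *\<^sub>R v)) - M * (q \<bullet> v) \<le> (\<Sum>c\<in>C. w c * g (u - c))"
    using assms(4) unfolding subdiff_def by (force simp: inner_diff_right dest: spec[of _ "u - M *\<^sub>R v"])
  have "w c * M - w c * g (c - u) \<le> w c * g (u - c + M *\<^sub>R v)" if "c \<in> C" for c
  proof -
    have "M - g (c - u) \<le> g (u - c + M *\<^sub>R v)"
      using triangle[of "u - c + M *\<^sub>R v" "c - u"] assms(2) by simp
    with assms(3) \<open>c \<in> C\<close> show ?thesis
      by (metis mult_left_mono right_diff_distrib)
  qed
  then have "M * (\<Sum>c\<in>C. w c) - (\<Sum>c\<in>C. w c * g (c - u)) \<le> (\<Sum>c\<in>C. w c * g (u - c + M *\<^sub>R v))"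
    by (simp add: sum_distrib_left mult.commute[of M] sum_subtractf[symmetric] sum_mono)
  with subgradient show ?thesis
    by (simp add: distrib_left sum.distrib)
qed

theorem mainTheorem3:
  fixes B :: "'a::euclidean_space set" and C :: "'a set" and w :: "'a \<Rightarrow> real"
    and v :: 'a and U :: "'a set" and \<tau> :: real
  assumes "convex B" and "compact B" and "0 \<in> interior B"
    and "v \<in> SD (minkowski_gauge B)"
    and "finite C" and "\<forall>c\<in>C. w c > 0"
    and "bounded U" and "\<tau> > 0"
  shows "\<exists>M0>0. \<forall>M>M0. \<forall>u\<in>U.
           \<forall>q\<in>subdiff (\<lambda>x. \<Sum>c\<in>C. w c * minkowski_gauge B (x - c + M *\<^sub>R v)) u.
             dual_gauge (minkowski_gauge B) (- q)
               > skewness (minkowski_gauge B) * (\<Sum>c\<in>C. w c) - \<tau>"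
proof -
  let ?g = "minkowski_gauge B" and ?\<sigma> = "skewness (minkowski_gauge B)"
  have w: "\<forall>c\<in>C. w c \<ge> 0"
    using assms(6) by (auto simp: less_imp_le)
  obtain L where L: "L \<ge> 0" "\<And>x. ?g x \<le> L * norm x"
    using minkowski_gauge_le_mult_norm[OF assms(3)] by blast
  obtain K where K: "\<And>u. u \<in> U \<Longrightarrow> (\<Sum>c\<in>C. w c * (?g (c - u) + ?g (u - c))) \<le> K"
    using weighted_gauge_sum_bounded[OF assms(7) L w] by blast
  show ?thesis
  proof (intro exI[of _ "max 1 (?\<sigma> * K / \<tau>)"] conjI allI impI ballI)
    fix M u q
    assume "M > max 1 (?\<sigma> * K / \<tau>)" "u \<in> U"
      and q: "q \<in> subdiff (\<lambda>x. \<Sum>c\<in>C. w c * ?g (x - c + M *\<^sub>R v)) u"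
    then have "M > 0" "?\<sigma> * K < \<tau> * M"
      using \<open>\<tau> > 0\<close> by (auto simp: pos_divide_less_eq mult.commute)
    have "?g (M *\<^sub>R v) = M"
      using minkowski_gauge_scaleR[OF assms(3) \<open>M > 0\<close>] assms(4) unfolding SD_def by simp
    then have "M * (\<Sum>c\<in>C. w c) - (\<Sum>c\<in>C. w c * (?g (c - u) + ?g (u - c))) \<le> M * (q \<bullet> v)"
      by (rule subgradient_inner_lower_bound[OF minkowski_gauge_triangle[OF assms(1,3)] _ w q])
    with K[OF \<open>u \<in> U\<close>] have "?\<sigma> * (M * (\<Sum>c\<in>C. w c) - K) \<le> ?\<sigma> * (M * (q \<bullet> v))"
      using SD_imp_skewness_pos[OF assms(3,4)] by (intro mult_left_mono) auto
    with \<open>?\<sigma> * K < \<tau> * M\<close> have "M * (?\<sigma> * (\<Sum>c\<in>C. w c) - \<tau>) < M * (?\<sigma> * (q \<bullet> v))"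
      by (simp add: algebra_simps)
    then show "dual_gauge ?g (- q) > ?\<sigma> * (\<Sum>c\<in>C. w c) - \<tau>"
      using skewness_inner_le_dual_gauge[OF compact_imp_bounded[OF assms(2)] assms(3,4), of q] \<open>M > 0\<close>
      by simp
  qed simp
qed

end
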